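(* Let $\mathcal{X}\in\{\mathrm{III},\mathrm{IV},\mathrm{V},\mathrm{VI}\}$, let $(\varepsilon,A,k,t)$ be admissible parameters of Type $\mathcal{X}$, and let $P=P_{\mathcal{X}}(\varepsilon,A,k,t)$, so that $L(P)=K_{\mathcal{X}}(\delta,\varepsilon,A,k,t)$ for a suitable sign $\delta\in\{\pm1\}$. Then the area of the L-shaped curve $P$ is equal to the absolute value of the coefficient of the lens space surgery of $L(P)$ as in Type $\mathcal{X}$, or is greater by one: $$\mathrm{area}(P)-|\mathrm{coef}(L(P))|=0\ \text{ or }\ 1.$$
   Context: **Braids.** Let $\sigma_1,\dots,\sigma_{m-1}$ be the standard positive generators of the braid group of index $m$, with sign chosen so that the closure of $(\sigma_{m-1}\cdots\sigma_1)^q$ ($q>0$) is the positive torus link $T(m,q)$. For $1\le n\le m$ put $W(n)=\sigma_{n-1}\sigma_{n-2}\cdots\sigma_1$ ($W(1)=1$). Knots and links in $S^3$ are unoriented and considered up to isotopy. **Berge's knots.** Parameters: $\delta,\varepsilon\in\{\pm1\}$, a positive integer $A$, $k\in\mathbf{Z}_{\ge0}$, $t\in\mathbf{Z}$; constants $a\in\{0,1\}$, $B>0$, $b\in\mathbf{Z}$ are given by: - Type III: $a=0$, $A\ge2$, $B=A(3+2k)-\varepsilon$, $b=-\delta\varepsilon(2A+tB)$. - Type IV: $a=1$, $A\ge5$ odd, $B=(A(5+2k)-\varepsilon)/2$, $b=-\delta\varepsilon(A+tB)$. - Type V: $a=1$, $A\ge3$ odd, $B=A(2+k)+1$ if $\varepsilon=1$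 and $B=A(3+k)-1$ if $\varepsilon=-1$, $b=-\delta\varepsilon(A+tB)$. - Type VI: $a=0$, $A\ge4$ even, $\varepsilon=-1$ and $k=0$ fixed, $B=2A+1$, $b=\delta(A-1+tB)$. $K_{\mathcal{X}}(\delta,\varepsilon,A,k,t)$ is the knot in $S^3$ that is the closure of the braid $W(B)^{b}\,W(A+1-a)^{\delta}$ of index $B$ (Berge's braid presentation). Its surgery coefficient as in Type $\mathcal{X}$ is $\mathrm{coef}(K_{\mathcal{X}}(\delta,\varepsilon,A,k,t))=bB+\delta A$ (by Berge, surgery with this coefficient yields a lens space). Reversing $\delta$ gives the mirror image and changes the sign of the coefficient. **L-shaped curves.** Let $X=\{(x,y)\in\mathbf{R}^2:\cos\pi x=\cos\pi y\}$. A lattice point $(m,n)\in\mathbf{Z}^2$ is even (odd) if $m+n$ is even (odd). For positive integers $a_1<a_2$, $b_1<b_2$, let $$L[a_1,a_2;b_1,b_2]=\{0\le x\le a_1,\ 0\le y\le b_2\}\cup\{0\le x\le a_2,\ 0\le y\le b_1\},$$ with concave corner $(a_1,b_1)$. An L-shaped region of type $[a_1,a_2;b_1,b_2]$ is an image of this set under a composition of the reflection in the $x$-axis, rotations by $\pi/2$ about lattice points and translations by lattice points; it is always assumed that its concave corner is at an odd lattice point. The L-shaped curve of this type is $P=X\cap\mathcal{L}$ for such a region $\mathcal{L}$; up to isotopy it depends only on the type. The region is regarded as a disk and $P$, after smoothing its corners, as a divide: the even interior lattice points are the double points, $P$ turns back (smoothed, inside the disk) at even lattice points of the boundary which are not corners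 of the region, and $P$ ends on the boundary at the even corners. $\mathrm{area}(P)$ is the area of the region $\mathcal{L}$, i.e. $a_2b_1+a_1b_2-a_1b_1$. **The curves $P_{\mathcal{X}}(\varepsilon,A,k,t)$.** Put $\mathrm{sgn}(t)=1$ if $t\ge0$ and $\mathrm{sgn}(t)=-1$ if $t<0$. Let $n=|\beta+tB|$, where $\beta=2A$ in Type III, $\beta=A$ in Types IV and V, $\beta=A-1$ in Type VI. Then $P_{\mathcal{X}}(\varepsilon,A,k,t)$ is the L-shaped curve of type - $[\,B-A+a,\ B;\ n-1,\ n\,]$ if $\varepsilon\cdot\mathrm{sgn}(t)=+1$, - $[\,A+1-a,\ B;\ n,\ n+1\,]$ if $\varepsilon\cdot\mathrm{sgn}(t)=-1$. **Divide links.** For a divide $P$ (a relative generic immersion of a compact 1-manifold in the unit disk $D\subset\mathbf{R}^2$), $$L(P)=\{(x,v)\in D\times\mathbf{R}^2: x\in P,\ v\in T_xP,\ |x|^2+|v|^2=1\}\subset S^3,$$ where $T_xP$ is the set of vectors tangent to some branch of $P$ at $x$, and $S^3\subset\mathbf{R}^2\times\mathbf{R}^2=\mathbf{C}^2$ via $(x,v)\mapsto x+iv$ with the standard orientation. $\mathrm{coef}(L(P))$ denotes $\mathrm{coef}(K_{\mathcal{X}}(\delta,\varepsilon,A,k,t))$ for the sign $\delta$ with $L(P)=K_{\mathcal{X}}(\delta,\varepsilon,A,k,t)$; its absolute value does not depend on the choice of sign. *)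

theory Defs
  imports "HOL-Analysis.Analysis"
begin

section \<open>Links in the 3-sphere up to isotopy\<close>

type_synonym plane = "real \<times> real"

definition S3 :: "(complex \<times> complex) set" where
  "S3 = sphere 0 1"

text \<open>A link is an unoriented subset of \<open>S3\<close>; isotopy is ambient isotopy, i.e. a homotopy
  starting at the identity each of whose stages is a homeomorphism of \<open>S3\<close>.\<close>

definition isotopic :: "(complex \<times> complex) set \<Rightarrow> (complex \<times> complex) set \<Rightarrow> bool" where
  "isotopic \<Lambda> \<Lambda>' \<longleftrightarrow>
     (\<exists>f. homotopic_with_canon (\<lambda>g. \<exists>g'. homeomorphism S3 S3 g g') S3 S3 id f \<and> f ` \<Lambda> = \<Lambda>')"

type_synonym link_type = "(complex \<times> complex) set set"

definition link_class :: "(complex \<times> complex) set \<Rightarrow> link_type" where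
  "link_class \<Lambda> = {\<Lambda>'. isotopic \<Lambda> \<Lambda>'}"


section \<open>Braids and their closures\<close>

text \<open>The letter \<open>(i, True)\<close> stands for \<open>\<sigma>\<^sub>i\<close> and \<open>(i, False)\<close> for its inverse.\<close>

type_synonym braid_word = "(nat \<times> bool) list"

definition braid_inv :: "braid_word \<Rightarrow> braid_word" where
  "braid_inv w = map (\<lambda>(i, s). (i, \<not> s)) (rev w)"

definition braid_power :: "braid_word \<Rightarrow> int \<Rightarrow> braid_word" where
  "braid_power w b =
     (if b \<ge> 0 then concat (replicate (nat b) w)
      else concat (replicate (nat (- b)) (braid_inv w)))"

definition W :: "nat \<Rightarrow> braid_word" where
  "W n = map (\<lambda>i. (i, True)) (rev [1..<n])"

text \<open>The \<open>m\<close> strands of a braid move in the complex plane and rest at the points \<open>1, \<dots>, m\<close>.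
  At time \<open>u \<in> {0..1}\<close> of the letter \<open>\<sigma>\<^sub>i\<close> the points \<open>i\<close> and \<open>i + 1\<close> have been turned
  counterclockwise by the angle \<open>\<pi> u\<close> around their midpoint.\<close>

fun letter_points :: "nat \<Rightarrow> nat \<times> bool \<Rightarrow> real \<Rightarrow> complex set" where
  "letter_points m (i, s) u =
     (let c = of_nat i + 1/2; e = cis ((if s then 1 else -1) * pi * u) / 2
      in of_nat ` ({1..m} - {i, i + 1}) \<union> {c + e, c - e})"

definition slice_points :: "nat \<Rightarrow> braid_word \<Rightarrow> nat \<Rightarrow> real \<Rightarrow> complex set" where
  "slice_points m w j u = (if j < length w then letter_points m (w ! j) u else of_nat ` {1..m})"

text \<open>The closed braid lies in \<open>\<complex> \<times> {\<zeta>. \<bar>\<zeta>\<bar> = 1}\<close>, which the radial projection \<open>sgn\<close> embeds in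
  \<open>S3\<close> as the complement of the braid axis. The time circle is divided into one slice for each
  letter and one more slice in which the strands rest, so that the empty word is covered too.
  The closure of \<open>(\<sigma>\<^sub>m\<^sub>-\<^sub>1 \<cdots> \<sigma>\<^sub>1)\<^sup>q\<close>, \<open>q > 0\<close>, is isotopic to the link \<open>z\<^sup>m = \<zeta>\<^sup>q\<close> in \<open>S3\<close>, i.e. to
  the positive torus link \<open>T(m, q)\<close>.\<close>

definition braid_closure :: "nat \<Rightarrow> braid_word \<Rightarrow> (complex \<times> complex) set" where
  "braid_closure m w =
     {sgn (z, cis (2 * pi * (real j + u) / real (length w + 1))) | z j u.
        j \<le> length w \<and> 0 \<le> u \<and> u \<le> 1 \<and> z \<in> slice_points m w j u}"


section \<open>Berge's knots\<close>

datatype berge_type = Type_III | Type_IV | Type_V | Type_VI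

fun admissible :: "berge_type \<Rightarrow> int \<Rightarrow> int \<Rightarrow> nat \<Rightarrow> int \<Rightarrow> bool" where
  "admissible Type_III \<epsilon> A k t \<longleftrightarrow> \<epsilon> \<in> {1, -1} \<and> A \<ge> 2"
| "admissible Type_IV \<epsilon> A k t \<longleftrightarrow> \<epsilon> \<in> {1, -1} \<and> A \<ge> 5 \<and> odd A"
| "admissible Type_V \<epsilon> A k t \<longleftrightarrow> \<epsilon> \<in> {1, -1} \<and> A \<ge> 3 \<and> odd A"
| "admissible Type_VI \<epsilon> A k t \<longleftrightarrow> \<epsilon> = -1 \<and> k = 0 \<and> A \<ge> 4 \<and> even A"

fun par_a :: "berge_type \<Rightarrow> int" where
  "par_a Type_III = 0"
| "par_a Type_IV = 1"
| "par_a Type_V = 1"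
| "par_a Type_VI = 0"

text \<open>In Type IV the division is exact for admissible parameters.\<close>

fun par_B :: "berge_type \<Rightarrow> int \<Rightarrow> int \<Rightarrow> nat \<Rightarrow> int" where
  "par_B Type_III \<epsilon> A k = A * (3 + 2 * int k) - \<epsilon>"
| "par_B Type_IV \<epsilon> A k = (A * (5 + 2 * int k) - \<epsilon>) div 2"
| "par_B Type_V \<epsilon> A k = (if \<epsilon> = 1 then A * (2 + int k) + 1 else A * (3 + int k) - 1)"
| "par_B Type_VI \<epsilon> A k = 2 * A + 1"

fun par_b :: "berge_type \<Rightarrow> int \<Rightarrow> int \<Rightarrow> int \<Rightarrow> nat \<Rightarrow> int \<Rightarrow> int" where
  "par_b Type_III \<delta> \<epsilon> A k t = - \<delta> * \<epsilon> * (2 * A + t * par_B Type_III \<epsilon> A k)"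
| "par_b Type_IV \<delta> \<epsilon> A k t = - \<delta> * \<epsilon> * (A + t * par_B Type_IV \<epsilon> A k)"
| "par_b Type_V \<delta> \<epsilon> A k t = - \<delta> * \<epsilon> * (A + t * par_B Type_V \<epsilon> A k)"
| "par_b Type_VI \<delta> \<epsilon> A k t = \<delta> * (A - 1 + t * par_B Type_VI \<epsilon> A k)"

definition berge_braid :: "berge_type \<Rightarrow> int \<Rightarrow> int \<Rightarrow> int \<Rightarrow> nat \<Rightarrow> int \<Rightarrow> braid_word" where
  "berge_braid X \<delta> \<epsilon> A k t =
     braid_power (W (nat (par_B X \<epsilon> A k))) (par_b X \<delta> \<epsilon> A k t) @
     braid_power (W (nat (A + 1 - par_a X))) \<delta>"

definition berge_knot :: "berge_type \<Rightarrow> int \<Rightarrow> int \<Rightarrow> int \<Rightarrow> nat \<Rightarrow> int \<Rightarrow> link_type" where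
  "berge_knot X \<delta> \<epsilon> A k t =
     link_class (braid_closure (nat (par_B X \<epsilon> A k)) (berge_braid X \<delta> \<epsilon> A k t))"

definition coef :: "berge_type \<Rightarrow> int \<Rightarrow> int \<Rightarrow> int \<Rightarrow> nat \<Rightarrow> int \<Rightarrow> int" where
  "coef X \<delta> \<epsilon> A k t = par_b X \<delta> \<epsilon> A k t * par_B X \<epsilon> A k + \<delta> * A"

text \<open>The coefficient of a link \<open>\<Lambda>\<close> which is \<open>berge_knot X \<delta> \<epsilon> A k t\<close> for a sign \<open>\<delta>\<close>: the
  alternative to \<open>\<delta> = 1\<close> is \<open>\<delta> = -1\<close>. If both signs occur, the absolute value is the same.\<close>

definition coef_of_link :: "berge_type \<Rightarrow> int \<Rightarrow> int \<Rightarrow> nat \<Rightarrow> int \<Rightarrow> link_type \<Rightarrow> int" where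
  "coef_of_link X \<epsilon> A k t \<Lambda> =
     coef X (if \<Lambda> = berge_knot X 1 \<epsilon> A k t then 1 else -1) \<epsilon> A k t"


section \<open>Divides and their links\<close>

text \<open>A divide is given by parametrizations of its branches: immersed intervals, parametrized
  by \<open>{0..1}\<close>, and immersed circles, given as closed curves parametrized by \<open>{0..1}\<close>.\<close>

datatype branch = is_Arc: Arc (curve: "real \<Rightarrow> plane") | is_Loop: Loop (curve: "real \<Rightarrow> plane")

type_synonym divide = "branch list"

definition smooth_branch :: "branch \<Rightarrow> bool" where
  "smooth_branch c \<longleftrightarrow>
     (\<exists>F :: nat \<Rightarrow> real \<Rightarrow> plane. F 0 = curve c \<and>
        (\<forall>n. \<forall>s\<in>{0..1}. (F n has_vector_derivative F (Suc n) s) (at s within {0..1})) \<and>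
        (is_Loop c \<longrightarrow> (\<forall>n. F n 0 = F n 1)))"

text \<open>The points of the 1-manifold; on a circle the parameters 0 and 1 are the same point.\<close>

definition params :: "divide \<Rightarrow> (nat \<times> real) set" where
  "params D = {(i, s). i < length D \<and> s \<in> (if is_Loop (D ! i) then {0..<1} else {0..1})}"

definition ends :: "divide \<Rightarrow> (nat \<times> real) set" where
  "ends D = {(i, s) \<in> params D. is_Arc (D ! i) \<and> s \<in> {0, 1}}"

definition pt :: "divide \<Rightarrow> nat \<times> real \<Rightarrow> plane" where
  "pt D p = curve (D ! fst p) (snd p)"

definition vel :: "divide \<Rightarrow> nat \<times> real \<Rightarrow> plane" where
  "vel D p = vector_derivative (curve (D ! fst p)) (at (snd p) within {0..1})"

text \<open>Relative generic immersions in the unit disk: the ends of the arcs are distinct boundary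
  points at which the curve is transverse to the boundary, everything else lies in the interior,
  and the only singularities are transverse double points.\<close>

definition is_divide :: "divide \<Rightarrow> bool" where
  "is_divide D \<longleftrightarrow>
     (\<forall>c\<in>set D. smooth_branch c) \<and>
     (\<forall>p\<in>params D. vel D p \<noteq> 0) \<and>
     (\<forall>p\<in>params D - ends D. norm (pt D p) < 1) \<and>
     (\<forall>p\<in>ends D. norm (pt D p) = 1 \<and> vel D p \<bullet> pt D p \<noteq> 0) \<and>
     inj_on (pt D) (ends D) \<and>
     (\<forall>p\<in>params D. \<forall>q\<in>params D. p \<noteq> q \<and> pt D p = pt D q \<longrightarrow>
        fst (vel D p) * snd (vel D q) \<noteq> snd (vel D p) * fst (vel D q)) \<and>
     (\<forall>p\<in>params D. \<forall>q\<in>params D. \<forall>r\<in>params D.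
        pt D p = pt D q \<and> pt D q = pt D r \<longrightarrow> p = q \<or> q = r \<or> p = r)"

definition tangent_vectors :: "divide \<Rightarrow> plane \<Rightarrow> plane set" where
  "tangent_vectors D x = {c *\<^sub>R vel D p | c p. p \<in> params D \<and> pt D p = x}"

text \<open>\<open>(x, v)\<close> is identified with \<open>x + \<i> v \<in> \<complex>\<^sup>2\<close>.\<close>

definition divide_link :: "divide \<Rightarrow> (complex \<times> complex) set" where
  "divide_link D =
     {(Complex (fst x) (fst v), Complex (snd x) (snd v)) | x v.
        x \<in> pt D ` params D \<and> v \<in> tangent_vectors D x \<and> (norm x)\<^sup>2 + (norm v)\<^sup>2 = 1}"


section \<open>L-shaped curves\<close>

definition X_grid :: "plane set" where
  "X_grid = {(x, y). cos (pi * x) = cos (pi * y)}"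

definition even_point :: "plane \<Rightarrow> bool" where
  "even_point p \<longleftrightarrow> (\<exists>m n :: int. p = (of_int m, of_int n) \<and> even (m + n))"

definition odd_point :: "plane \<Rightarrow> bool" where
  "odd_point p \<longleftrightarrow> (\<exists>m n :: int. p = (of_int m, of_int n) \<and> odd (m + n))"

text \<open>The tuple \<open>(a\<^sub>1, a\<^sub>2, b\<^sub>1, b\<^sub>2)\<close> stands for the type \<open>[a\<^sub>1, a\<^sub>2; b\<^sub>1, b\<^sub>2]\<close>.\<close>

type_synonym L_type = "int \<times> int \<times> int \<times> int"

fun valid_L_type :: "L_type \<Rightarrow> bool" where
  "valid_L_type (a1, a2, b1, b2) \<longleftrightarrow> 0 < a1 \<and> a1 < a2 \<and> 0 < b1 \<and> b1 < b2"

fun L_set :: "L_type \<Rightarrow> plane set" where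
  "L_set (a1, a2, b1, b2) =
     {(x, y). 0 \<le> x \<and> x \<le> of_int a1 \<and> 0 \<le> y \<and> y \<le> of_int b2} \<union>
     {(x, y). 0 \<le> x \<and> x \<le> of_int a2 \<and> 0 \<le> y \<and> y \<le> of_int b1}"

fun L_concave :: "L_type \<Rightarrow> plane" where
  "L_concave (a1, a2, b1, b2) = (of_int a1, of_int b1)"

fun L_corners :: "L_type \<Rightarrow> plane set" where
  "L_corners (a1, a2, b1, b2) =
     {(0, 0), (of_int a2, 0), (of_int a2, of_int b1), (of_int a1, of_int b1),
      (of_int a1, of_int b2), (0, of_int b2)}"

inductive lattice_motion :: "(plane \<Rightarrow> plane) \<Rightarrow> bool" where
  identity: "lattice_motion id"
| reflection: "lattice_motion f \<Longrightarrow> lattice_motion ((\<lambda>(x, y). (x, - y)) \<circ> f)"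
| rotation: "lattice_motion f \<Longrightarrow>
    lattice_motion ((\<lambda>(x, y). (of_int c - (y - of_int d), of_int d + (x - of_int c))) \<circ> f)"
    for c d :: int
| translation: "lattice_motion f \<Longrightarrow>
    lattice_motion ((\<lambda>(x, y). (x + of_int c, y + of_int d)) \<circ> f)" for c d :: int

text \<open>An L-shaped region is given by its type \<open>\<tau>\<close> and by the motion \<open>\<phi>\<close> that puts it in place.\<close>

definition is_L_region :: "L_type \<Rightarrow> (plane \<Rightarrow> plane) \<Rightarrow> bool" where
  "is_L_region \<tau> \<phi> \<longleftrightarrow> valid_L_type \<tau> \<and> lattice_motion \<phi> \<and> odd_point (\<phi> (L_concave \<tau>))"

definition L_region :: "L_type \<Rightarrow> (plane \<Rightarrow> plane) \<Rightarrow> plane set" where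
  "L_region \<tau> \<phi> = \<phi> ` L_set \<tau>"

definition L_curve :: "L_type \<Rightarrow> (plane \<Rightarrow> plane) \<Rightarrow> plane set" where
  "L_curve \<tau> \<phi> = X_grid \<inter> L_region \<tau> \<phi>"

definition L_area :: "L_type \<Rightarrow> (plane \<Rightarrow> plane) \<Rightarrow> real" where
  "L_area \<tau> \<phi> = measure lebesgue (L_region \<tau> \<phi>)"

definition turn_points :: "L_type \<Rightarrow> (plane \<Rightarrow> plane) \<Rightarrow> plane set" where
  "turn_points \<tau> \<phi> = {p \<in> frontier (L_region \<tau> \<phi>). even_point p \<and> p \<notin> \<phi> ` L_corners \<tau>}"

text \<open>At a point \<open>p\<close> where the curve turns back, it consists of two segments meeting on the
  boundary. They are cut off at distance \<open>1/2\<close> from \<open>p\<close> and joined by a chord, which lies in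
  the interior of the region. The result has corners; it only serves to fix the topological
  position in the region of the smooth divide.\<close>

definition pushed_L_curve :: "L_type \<Rightarrow> (plane \<Rightarrow> plane) \<Rightarrow> plane set" where
  "pushed_L_curve \<tau> \<phi> =
     (L_curve \<tau> \<phi> - (\<Union>p\<in>turn_points \<tau> \<phi>. ball p (1/2))) \<union>
     (\<Union>p\<in>turn_points \<tau> \<phi>. convex hull (L_curve \<tau> \<phi> \<inter> sphere p (1/2)))"

text \<open>The L-shaped curve as a divide: the region is identified with the unit disk by a
  homeomorphism, under which the curve becomes the image of a smooth generic immersion. The
  homeomorphism need not preserve the orientation, because reflecting a divide induces an
  orientation preserving symmetry of \<open>S3\<close>. The isotopy class of the divide link does not depend
  on the choices.\<close>

definition divide_of_L_curve :: "L_type \<Rightarrow> (plane \<Rightarrow> plane) \<Rightarrow> divide \<Rightarrow> bool" where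
  "divide_of_L_curve \<tau> \<phi> D \<longleftrightarrow> is_divide D \<and>
     (\<exists>h h'. homeomorphism (L_region \<tau> \<phi>) (cball 0 1) h h' \<and>
             h ` pushed_L_curve \<tau> \<phi> = pt D ` params D)"

definition link_of_L_curve :: "L_type \<Rightarrow> (plane \<Rightarrow> plane) \<Rightarrow> link_type" where
  "link_of_L_curve \<tau> \<phi> =
     {\<Lambda>. \<exists>D. divide_of_L_curve \<tau> \<phi> D \<and> isotopic (divide_link D) \<Lambda>}"


section \<open>The L-shaped curves of Berge's knots\<close>

fun par_beta :: "berge_type \<Rightarrow> int \<Rightarrow> int" where
  "par_beta Type_III A = 2 * A"
| "par_beta Type_IV A = A"
| "par_beta Type_V A = A"
| "par_beta Type_VI A = A - 1"

definition sgn1 :: "int \<Rightarrow> int" where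
  "sgn1 t = (if t \<ge> 0 then 1 else -1)"

definition berge_L_type :: "berge_type \<Rightarrow> int \<Rightarrow> int \<Rightarrow> nat \<Rightarrow> int \<Rightarrow> L_type" where
  "berge_L_type X \<epsilon> A k t =
     (let a = par_a X; B = par_B X \<epsilon> A k; n = \<bar>par_beta X A + t * B\<bar>
      in if \<epsilon> * sgn1 t = 1 then (B - A + a, B, n - 1, n) else (A + 1 - a, B, n, n + 1))"

end

theory Submission
  imports Defs
begin

text \<open>
  The absolute value of the surgery coefficient is the same for both signs \<open>\<delta>\<close>, because
  reversing \<open>\<delta>\<close> reverses the whole coefficient. So the comparison does not
  depend on which of the two mirror images the divide link is: the area and the absolute value of
  the coefficient are explicit functions of the parameters.

  The region is the union of two rectangles that overlap in a third one, and a lattice motion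
  carries upright rectangles to upright rectangles of the same area, so the area of a region of type
  \<open>[a\<^sub>1, a\<^sub>2; b\<^sub>1, b\<^sub>2]\<close> is \<open>a\<^sub>2 b\<^sub>1 + a\<^sub>1 b\<^sub>2 - a\<^sub>1 b\<^sub>1\<close> wherever it lies (\<open>L_area_eq\<close>).

  In all four types the exponent of \<open>W(B)\<close> is \<open>b = - \<delta> \<epsilon> (\<beta> + t B)\<close>, and \<open>0 < \<beta> < B\<close>
  forces \<open>\<beta> + t B\<close> to have the sign of \<open>t\<close> (\<open>shifted_multiple_sign\<close>). With \<open>n = \<bar>\<beta> + t B\<bar> \<ge> 1\<close>
  the coefficient is therefore, up to sign, \<open>A - \<epsilon> sgn(t) n B\<close>. If \<open>\<epsilon> sgn(t) = 1\<close>, its absolute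
  value is \<open>n B - A\<close>, because \<open>A < B\<close>, while the area is \<open>B (n - 1) + (B - A + a) = n B - A + a\<close>; if
  \<open>\<epsilon> sgn(t) = -1\<close>, it is \<open>n B + A\<close> while the area is \<open>B n + (A + 1 - a)\<close>. The difference is
  \<open>a\<close> in the first case and \<open>1 - a\<close> in the second one.
\<close>

lemma measure_rectangle:
  fixes x y p q :: real
  assumes "0 \<le> p" "0 \<le> q"
  shows "measure lebesgue ({x..x + p} \<times> {y..y + q}) = p * q"
proof -
  have "{x..x + p} \<times> {y..y + q} = cbox (x, y) (x + p, y + q)"
    by (simp add: cbox_Pair_eq)
  then show ?thesis
    using assms by (simp add: content_Pair)
qed

lemma inj_lattice_motion: "lattice_motion f \<Longrightarrow> inj f"
proof (induction rule: lattice_motion.induct)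
  case identity
  show ?case by simp
next
  case (reflection f)
  then show ?case by (intro inj_compose) (auto simp: inj_def)
next
  case (rotation f c d)
  then show ?case by (intro inj_compose) (auto simp: inj_def)
next
  case (translation f c d)
  then show ?case by (intro inj_compose) (auto simp: inj_def)
qed

lemma reflect_rectangle:
  fixes x y p q :: real
  shows "(\<lambda>(x, y). (x, - y)) ` ({x..x + p} \<times> {y..y + q}) =
    {x..x + p} \<times> {- y - q..(- y - q) + q}"
proof (intro equalityI subsetI)
  fix z assume z: "z \<in> {x..x + p} \<times> {- y - q..(- y - q) + q}"
  then show "z \<in> (\<lambda>(x, y). (x, - y)) ` ({x..x + p} \<times> {y..y + q})"
    by (intro image_eqI[of _ _ "(fst z, - snd z)"]) auto
qed auto

lemma rotate_rectangle:
  fixes x y p q c d :: real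
  shows "(\<lambda>(x, y). (c - (y - d), d + (x - c))) ` ({x..x + p} \<times> {y..y + q}) =
    {c + d - y - q..(c + d - y - q) + q} \<times> {d - c + x..(d - c + x) + p}"
proof (intro equalityI subsetI)
  fix z
  assume z: "z \<in> {c + d - y - q..(c + d - y - q) + q} \<times> {d - c + x..(d - c + x) + p}"
  then show "z \<in> (\<lambda>(x, y). (c - (y - d), d + (x - c))) ` ({x..x + p} \<times> {y..y + q})"
    by (intro image_eqI[of _ _ "(snd z - d + c, c + d - fst z)"]) auto
qed auto

lemma translate_rectangle:
  fixes x y p q c d :: real
  shows "(\<lambda>(x, y). (x + c, y + d)) ` ({x..x + p} \<times> {y..y + q}) =
    {x + c..(x + c) + p} \<times> {y + d..(y + d) + q}"
proof (intro equalityI subsetI)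
  fix z assume z: "z \<in> {x + c..(x + c) + p} \<times> {y + d..(y + d) + q}"
  then show "z \<in> (\<lambda>(x, y). (x + c, y + d)) ` ({x..x + p} \<times> {y..y + q})"
    by (intro image_eqI[of _ _ "(fst z - c, snd z - d)"]) auto
qed auto

text \<open>A rotation by a right angle exchanges the two side lengths; their product survives.\<close>

lemma lattice_motion_rectangle:
  assumes "lattice_motion f"
  shows "\<exists>x' y' p' q'. f ` ({x..x + p} \<times> {y..y + q}) = {x'..x' + p'} \<times> {y'..y' + q'} \<and>
    ((p', q') = (p, q) \<or> (p', q') = (q, p))"
  using assms
proof (induction rule: lattice_motion.induct)
  case identity
  show ?case by (rule exI[of _ x], rule exI[of _ y], rule exI[of _ p], rule exI[of _ q]) simp
next
  case (reflection f)
  then show ?case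
    by (elim exE conjE)
      (simp only: image_comp[symmetric] reflect_rectangle, intro exI conjI, rule refl, auto)
next
  case (rotation f c d)
  then show ?case
    by (elim exE conjE)
      (simp only: image_comp[symmetric] rotate_rectangle, intro exI conjI, rule refl, auto)
next
  case (translation f c d)
  then show ?case
    by (elim exE conjE)
      (simp only: image_comp[symmetric] translate_rectangle, intro exI conjI, rule refl, auto)
qed

lemma measure_lattice_motion_rectangle:
  fixes x y p q :: real
  assumes "lattice_motion f" "0 \<le> p" "0 \<le> q"
  shows "f ` ({x..x + p} \<times> {y..y + q}) \<in> lmeasurable"
    and "measure lebesgue (f ` ({x..x + p} \<times> {y..y + q})) = p * q"
proof -
  obtain x' y' p' q' where
    im: "f ` ({x..x + p} \<times> {y..y + q}) = {x'..x' + p'} \<times> {y'..y' + q'}"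
    and pq: "(p', q') = (p, q) \<or> (p', q') = (q, p)"
    using lattice_motion_rectangle[OF assms(1)] by metis
  have "{x'..x' + p'} \<times> {y'..y' + q'} = cbox (x', y') (x' + p', y' + q')"
    by (simp add: cbox_Pair_eq)
  then show "f ` ({x..x + p} \<times> {y..y + q}) \<in> lmeasurable"
    unfolding im by simp
  show "measure lebesgue (f ` ({x..x + p} \<times> {y..y + q})) = p * q"
    unfolding im using pq assms by (auto simp: measure_rectangle)
qed

lemma L_area_eq:
  assumes "lattice_motion \<phi>" and "valid_L_type (a1, a2, b1, b2)"
  shows "L_area (a1, a2, b1, b2) \<phi> = of_int (a2 * b1 + a1 * b2 - a1 * b1)"
proof -
  define R where "R p q = {0..0 + real_of_int p} \<times> {0..0 + real_of_int q}" for p q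
  note rect = measure_lattice_motion_rectangle[OF assms(1), where x = 0 and y = 0, folded R_def]
  have pos: "0 < a1" "a1 < a2" "0 < b1" "b1 < b2"
    using assms(2) by auto
  have L: "L_set (a1, a2, b1, b2) = R a1 b2 \<union> R a2 b1" and I: "R a1 b2 \<inter> R a2 b1 = R a1 b1"
    using pos by (auto simp: R_def)
  have meas: "\<phi> ` R p q \<in> lmeasurable" "measure lebesgue (\<phi> ` R p q) = of_int p * of_int q"
    if "0 < p" "0 < q" for p q
    using rect[of "of_int p" "of_int q"] that by (auto simp: R_def)
  have "measure lebesgue (\<phi> ` R a1 b2 \<union> \<phi> ` R a2 b1) =
      measure lebesgue (\<phi> ` R a1 b2) + measure lebesgue (\<phi> ` R a2 b1)
      - measure lebesgue (\<phi> ` R a1 b2 \<inter> \<phi> ` R a2 b1)"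
    using meas pos by (intro measure_Un3) auto
  moreover have "\<phi> ` R a1 b2 \<inter> \<phi> ` R a2 b1 = \<phi> ` R a1 b1"
    using I image_Int[OF inj_lattice_motion[OF assms(1)]] by metis
  ultimately show ?thesis
    using meas pos by (simp add: L_area_def L_region_def L image_Un del: L_set.simps)
qed

lemma coef_uminus: "coef X (- \<delta>) \<epsilon> A k t = - coef X \<delta> \<epsilon> A k t"
  by (cases X) (simp_all add: coef_def del: par_B.simps)

lemma abs_coef_of_link: "\<bar>coef_of_link X \<epsilon> A k t \<Lambda>\<bar> = \<bar>coef X 1 \<epsilon> A k t\<bar>"
  using coef_uminus[of X 1 \<epsilon> A k t] by (auto simp: coef_of_link_def)

text \<open>Type VI fits the pattern of the other types because there \<open>\<epsilon> = -1\<close>.\<close>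

lemma coef_eq:
  assumes "admissible X \<epsilon> A k t"
  shows "coef X 1 \<epsilon> A k t =
    A - \<epsilon> * (par_beta X A + t * par_B X \<epsilon> A k) * par_B X \<epsilon> A k"
  using assms by (cases X) (auto simp: coef_def left_diff_distrib distrib_right simp del: par_B.simps)

lemma par_bounds:
  assumes "admissible X \<epsilon> A k t"
  shows "0 < par_beta X A" "par_beta X A < par_B X \<epsilon> A k" "0 < A" "A < par_B X \<epsilon> A k"
proof -
  have A: "0 < A" and \<epsilon>: "-1 \<le> \<epsilon>" "\<epsilon> \<le> 1"
    using assms by (cases X; auto)+
  then have k: "0 \<le> A * int k"
    by simp
  have "0 < par_beta X A \<and> par_beta X A < par_B X \<epsilon> A k \<and> A < par_B X \<epsilon> A k"
  proof (cases X)
    case Type_III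
    have "par_B X \<epsilon> A k = 3 * A + 2 * (A * int k) - \<epsilon>"
      by (simp add: Type_III distrib_left)
    moreover have "2 \<le> A" "par_beta X A = 2 * A"
      using assms by (simp_all add: Type_III)
    ultimately show ?thesis
      using k \<epsilon> by linarith
  next
    case Type_IV
    have "par_B X \<epsilon> A k = (5 * A + 2 * (A * int k) - \<epsilon>) div 2"
      by (simp add: Type_IV distrib_left)
    moreover have "5 \<le> A" "par_beta X A = A"
      using assms by (simp_all add: Type_IV)
    ultimately show ?thesis
      using k \<epsilon> by linarith
  next
    case Type_V
    consider "par_B X \<epsilon> A k = 2 * A + A * int k + 1" | "par_B X \<epsilon> A k = 3 * A + A * int k - 1"
      by (cases "\<epsilon> = 1") (simp_all add: Type_V distrib_left)
    moreover have "3 \<le> A" "par_beta X A = A"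
      using assms by (simp_all add: Type_V)
    ultimately show ?thesis
      using k by cases linarith+
  next
    case Type_VI
    then show ?thesis
      using assms by simp
  qed
  with A show "0 < par_beta X A" "par_beta X A < par_B X \<epsilon> A k" "0 < A" "A < par_B X \<epsilon> A k"
    by simp_all
qed

lemma shifted_multiple_sign:
  fixes \<beta> B t :: int
  assumes "0 < \<beta>" "\<beta> < B"
  shows "\<beta> + t * B = sgn1 t * \<bar>\<beta> + t * B\<bar>" and "1 \<le> \<bar>\<beta> + t * B\<bar>"
proof -
  have "\<beta> + t * B = sgn1 t * \<bar>\<beta> + t * B\<bar> \<and> 1 \<le> \<bar>\<beta> + t * B\<bar>"
  proof (cases "0 \<le> t")
    case True
    then have "0 < \<beta> + t * B"
      using assms by (intro add_pos_nonneg) simp_all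
    then show ?thesis
      using True by (simp add: sgn1_def)
  next
    case False
    then have "t * B \<le> (- 1) * B"
      using assms by (intro mult_right_mono) simp_all
    then have "\<beta> + t * B < 0"
      using assms by linarith
    then show ?thesis
      using False by (simp add: sgn1_def)
  qed
  then show "\<beta> + t * B = sgn1 t * \<bar>\<beta> + t * B\<bar>" "1 \<le> \<bar>\<beta> + t * B\<bar>"
    by blast+
qed

theorem theorem1p4:
  fixes X :: berge_type and \<epsilon> A t :: int and k :: nat and \<tau> :: L_type and \<phi> :: "plane \<Rightarrow> plane"
  assumes "admissible X \<epsilon> A k t"
    and "\<tau> = berge_L_type X \<epsilon> A k t"
    and "is_L_region \<tau> \<phi>"
  shows "L_area \<tau> \<phi> - real_of_int \<bar>coef_of_link X \<epsilon> A k t (link_of_L_curve \<tau> \<phi>)\<bar> \<in> {0, 1}"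
proof -
  define a where "a = par_a X"
  define B where "B = par_B X \<epsilon> A k"
  define n where "n = \<bar>par_beta X A + t * B\<bar>"
  define s where "s = \<epsilon> * sgn1 t"
  have motion: "lattice_motion \<phi>" and valid: "valid_L_type \<tau>"
    using assms(3) by (auto simp: is_L_region_def)
  have \<tau>: "\<tau> = (if s = 1 then (B - A + a, B, n - 1, n) else (A + 1 - a, B, n, n + 1))"
    by (simp add: assms(2) berge_L_type_def Let_def a_def B_def n_def s_def)
  have a: "a = 0 \<or> a = 1"
    by (cases X) (auto simp: a_def)
  have s: "s = 1 \<or> s = -1"
    using assms(1) by (cases X) (auto simp: s_def sgn1_def)
  note bounds = par_bounds[OF assms(1), folded B_def]
  note sign = shifted_multiple_sign[OF bounds(1,2), of t, folded n_def]
  have coef: "\<bar>coef_of_link X \<epsilon> A k t \<Lambda>\<bar> = \<bar>A - s * (n * B)\<bar>" for \<Lambda>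
    unfolding abs_coef_of_link coef_eq[OF assms(1)] B_def[symmetric]
    by (subst sign(1)) (simp add: s_def mult.assoc)
  have nB: "B \<le> n * B"
    using bounds sign(2) mult_right_mono[of 1 n B] by simp
  from s show ?thesis
  proof
    assume s: "s = 1"
    have "L_area \<tau> \<phi> = of_int (B * (n - 1) + (B - A + a) * n - (B - A + a) * (n - 1))"
      using L_area_eq[OF motion] valid by (simp add: \<tau> s)
    also have "\<dots> = of_int (n * B - A + a)"
      by (simp add: algebra_simps)
    finally have area: "L_area \<tau> \<phi> = of_int (n * B - A + a)" .
    have "\<bar>A - s * (n * B)\<bar> = n * B - A"
      using bounds nB unfolding s by linarith
    then show ?thesis
      unfolding coef area using a by auto
  next
    assume s: "s = -1"
    have "L_area \<tau> \<phi> = of_int (B * n + (A + 1 - a) * (n + 1) - (A + 1 - a) * n)"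
      using L_area_eq[OF motion] valid by (simp add: \<tau> s)
    also have "\<dots> = of_int (n * B + A + 1 - a)"
      by (simp add: algebra_simps)
    finally have area: "L_area \<tau> \<phi> = of_int (n * B + A + 1 - a)" .
    have "\<bar>A - s * (n * B)\<bar> = n * B + A"
      using bounds nB unfolding s by linarith
    then show ?thesis
      unfolding coef area using a by auto
  qed
qed

end
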